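(* Let $\nu=(\nu_n)$ and $\mu=(\mu_n)$ be two smooth sequences of submeasures such that, for some $\alpha\in(0,1]$, the ideal $\mathcal{Z}_\nu$ is $\alpha$-thick and $\mu$ is $\alpha$-flat. Then $\mathcal{J}(\mathcal{Z}_\nu,\mu)=\mathcal{Z}_\mu$, that is, $(\mathcal{Z}_\nu,\mu)$-convergence coincides with $\mathcal{Z}_\mu$-convergence.
   Context: $\mathbf{N}$ denotes the positive integers. An ideal on $\mathbf{N}$ is a family $\mathcal{I}\subseteq\mathcal{P}(\mathbf{N})$ closed under finite unions and subsets and containing all finite subsets of $\mathbf{N}$. A submeasure is a map $\varphi:\mathcal{P}(\mathbf{N})\to[0,\infty]$ such that $\varphi(\emptyset)=0$, $\varphi(A)\le\varphi(B)$ if $A\subseteq B$, $\varphi(A\cup B)\le\varphi(A)+\varphi(B)$, and $\varphi(\{n\})<\infty$ for all $n\in\mathbf{N}$. A sequence of submeasures $\mu=(\mu_n)$ is smooth if: (S1) for all $n$, $\mu_n$ is supported on a nonempty set $I_n\subseteq\mathbf{N}$ (i.e. $\mu_n(A)=\mu_n(A\cap I_n)$ for all $A$); (S2) $\lim_{n\to\infty}\mu_n(\{k\})=0$ for all $k\in\mathbf{N}$; (S3) $\limsup_{n\to\infty}\mu_n(\mathbf{N})>0$. For a smooth sequence $\mu$, $\mathcal{Z}_\mu:=\{A\subseteq\mathbf{N}:\limsup_{n\to\infty}\mu_n(A\cap I_n)=0\}$, which is an ideal. For a real $\alpha>0$, an ideal $\mathcal{I}$ is $\alpha$-thick if $A\notin\mathcal{I}$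 whenever there exist a real $c>0$ and infinitely many $n\in\mathbf{N}$ such that $\mathbf{N}\cap[n,n+cn^\alpha]\subseteq A$. A sequence of submeasures $\mu=(\mu_n)$ is $\alpha$-flat if for each $A\subseteq\mathbf{N}$ there exists a real $d=d(A)>0$ such that $|\mu_{n+1}(A)-\mu_n(A)|\le d/n^\alpha$ for all $n\in\mathbf{N}$. For an ideal $\mathcal{I}$ and a smooth sequence $\mu$, $\mathcal{J}(\mathcal{I},\mu)$ is the ideal $\{A\subseteq\mathbf{N}:\{n\in\mathbf{N}:\mu_n(A)\ge\varepsilon\}\in\mathcal{I}\text{ for all }\varepsilon>0\}$. A sequence $(x_n)$ in a Hausdorff space $X$ is $\mathcal{I}$-convergent to $\ell\in X$ if $\{n:x_n\notin U\}\in\mathcal{I}$ for all neighborhoods $U$ of $\ell$, and $(\mathcal{I},\mu)$-convergent to $\ell$ if $\{n\in\mathbf{N}:\mu_n(\{k\in\mathbf{N}:x_k\notin U\})\ge\varepsilon\}\in\mathcal{I}$ for each neighborhood $U$ of $\ell$ and each $\varepsilon>0$. $(\mathcal{I},\mu)$-convergence coincides with $\mathcal{J}$-convergence if, for some Hausdorff space $X$ with at least two points, every sequence $(x_n)$ in $X$ is $(\mathcal{I},\mu)$-convergent to $\ell\in X$ if and only if it is $\mathcal{J}$-convergent to $\ell$; $\mathcal{J}(\mathcal{I},\mu)$ is the unique ideal $\mathcal{J}$ with this property. *)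

theory Defs
  imports "HOL-Analysis.Analysis"
begin

abbreviation pos :: "nat set" where
  "pos \<equiv> {1..}"

definition ideal_on_pos :: "nat set set \<Rightarrow> bool" where
  "ideal_on_pos \<I> \<longleftrightarrow>
     \<I> \<subseteq> Pow pos \<and>
     (\<forall>A\<in>\<I>. \<forall>B\<in>\<I>. A \<union> B \<in> \<I>) \<and>
     (\<forall>A\<in>\<I>. \<forall>B\<subseteq>A. B \<in> \<I>) \<and>
     (\<forall>F\<subseteq>pos. finite F \<longrightarrow> F \<in> \<I>)"

text \<open>Submeasures live on subsets of \<open>pos\<close>; values on other sets of naturals are unconstrained
  and never used. Likewise, in a sequence of submeasures the entry with index 0 is never used.\<close>

definition submeasure :: "(nat set \<Rightarrow> ennreal) \<Rightarrow> bool" where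
  "submeasure \<phi> \<longleftrightarrow>
     \<phi> {} = 0 \<and>
     (\<forall>A B. A \<subseteq> B \<and> B \<subseteq> pos \<longrightarrow> \<phi> A \<le> \<phi> B) \<and>
     (\<forall>A B. A \<subseteq> pos \<and> B \<subseteq> pos \<longrightarrow> \<phi> (A \<union> B) \<le> \<phi> A + \<phi> B) \<and>
     (\<forall>n\<in>pos. \<phi> {n} < \<infinity>)"

text \<open>The supports \<open>I n\<close> are an explicit parameter.\<close>

definition smooth :: "(nat \<Rightarrow> nat set \<Rightarrow> ennreal) \<Rightarrow> (nat \<Rightarrow> nat set) \<Rightarrow> bool" where
  "smooth \<mu> I \<longleftrightarrow>
     (\<forall>n\<in>pos. submeasure (\<mu> n)) \<and>
     (\<forall>n\<in>pos. I n \<noteq> {} \<and> I n \<subseteq> pos \<and> (\<forall>A\<subseteq>pos. \<mu> n A = \<mu> n (A \<inter> I n))) \<and>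
     (\<forall>k\<in>pos. (\<lambda>n. \<mu> n {k}) \<longlonglongrightarrow> 0) \<and>
     limsup (\<lambda>n. \<mu> n pos) > 0"

definition Z_ideal :: "(nat \<Rightarrow> nat set \<Rightarrow> ennreal) \<Rightarrow> (nat \<Rightarrow> nat set) \<Rightarrow> nat set set" where
  "Z_ideal \<mu> I = {A. A \<subseteq> pos \<and> limsup (\<lambda>n. \<mu> n (A \<inter> I n)) = 0}"

definition thick :: "real \<Rightarrow> nat set set \<Rightarrow> bool" where
  "thick \<alpha> \<I> \<longleftrightarrow>
     (\<forall>A\<subseteq>pos.
        (\<exists>c>0. infinite {n \<in> pos. {k \<in> pos. real n \<le> real k \<and> real k \<le> real n + c * real n powr \<alpha>} \<subseteq> A})
        \<longrightarrow> A \<notin> \<I>)"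

text \<open>The absolute difference on \<open>[0,\<infinity>]\<close>. Subtraction on \<^typ>\<open>ennreal\<close> is truncated and has
  \<open>\<infinity> - \<infinity> = \<infinity>\<close>; here two infinite values have difference 0.\<close>

definition abs_diff :: "ennreal \<Rightarrow> ennreal \<Rightarrow> ennreal" where
  "abs_diff a b = (if a < b then b - a else if b < a then a - b else 0)"

definition flat :: "real \<Rightarrow> (nat \<Rightarrow> nat set \<Rightarrow> ennreal) \<Rightarrow> bool" where
  "flat \<alpha> \<mu> \<longleftrightarrow>
     (\<forall>A\<subseteq>pos. \<exists>d>0. \<forall>n\<in>pos.
        abs_diff (\<mu> (n + 1) A) (\<mu> n A) \<le> ennreal (d / real n powr \<alpha>))"

definition J_ideal :: "nat set set \<Rightarrow> (nat \<Rightarrow> nat set \<Rightarrow> ennreal) \<Rightarrow> nat set set" where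
  "J_ideal \<I> \<mu> =
     {A. A \<subseteq> pos \<and> (\<forall>\<epsilon>::real. \<epsilon> > 0 \<longrightarrow> {n \<in> pos. \<mu> n A \<ge> ennreal \<epsilon>} \<in> \<I>)}"

definition neighborhood :: "'x topology \<Rightarrow> 'x \<Rightarrow> 'x set \<Rightarrow> bool" where
  "neighborhood X l U \<longleftrightarrow> U \<subseteq> topspace X \<and> (\<exists>V. openin X V \<and> l \<in> V \<and> V \<subseteq> U)"

definition ideal_convergent ::
  "'x topology \<Rightarrow> nat set set \<Rightarrow> (nat \<Rightarrow> 'x) \<Rightarrow> 'x \<Rightarrow> bool" where
  "ideal_convergent X \<I> x l \<longleftrightarrow>
     (\<forall>U. neighborhood X l U \<longrightarrow> {n \<in> pos. x n \<notin> U} \<in> \<I>)"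

definition ideal_measure_convergent ::
  "'x topology \<Rightarrow> nat set set \<Rightarrow> (nat \<Rightarrow> nat set \<Rightarrow> ennreal) \<Rightarrow> (nat \<Rightarrow> 'x) \<Rightarrow> 'x \<Rightarrow> bool" where
  "ideal_measure_convergent X \<I> \<mu> x l \<longleftrightarrow>
     (\<forall>U. neighborhood X l U \<longrightarrow>
        (\<forall>\<epsilon>::real. \<epsilon> > 0 \<longrightarrow> {n \<in> pos. \<mu> n {k \<in> pos. x k \<notin> U} \<ge> ennreal \<epsilon>} \<in> \<I>))"

definition convergence_coincides_in ::
  "'x topology \<Rightarrow> nat set set \<Rightarrow> (nat \<Rightarrow> nat set \<Rightarrow> ennreal) \<Rightarrow> nat set set \<Rightarrow> bool" where
  "convergence_coincides_in X \<I> \<mu> \<J> \<longleftrightarrow>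
     (\<forall>x. (\<forall>n\<in>pos. x n \<in> topspace X) \<longrightarrow>
        (\<forall>l\<in>topspace X. ideal_measure_convergent X \<I> \<mu> x l \<longleftrightarrow> ideal_convergent X \<J> x l))"

definition nontrivial_Hausdorff :: "'x topology \<Rightarrow> bool" where
  "nontrivial_Hausdorff X \<longleftrightarrow>
     Hausdorff_space X \<and> (\<exists>a\<in>topspace X. \<exists>b\<in>topspace X. a \<noteq> b)"

text \<open>An existential over all spaces cannot range over types; the witness is sought among spaces
  carried by sets of reals.\<close>

definition convergence_coincides ::
  "nat set set \<Rightarrow> (nat \<Rightarrow> nat set \<Rightarrow> ennreal) \<Rightarrow> nat set set \<Rightarrow> bool" where
  "convergence_coincides \<I> \<mu> \<J> \<longleftrightarrow>
     (\<exists>X::real topology. nontrivial_Hausdorff X \<and> convergence_coincides_in X \<I> \<mu> \<J>)"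

lemma Z_ideal_iff:
  assumes "smooth \<mu> I"
  shows "A \<in> Z_ideal \<mu> I \<longleftrightarrow> A \<subseteq> pos \<and> (\<lambda>n. \<mu> n A) \<longlonglongrightarrow> 0"
proof (cases "A \<subseteq> pos")
  case True
  have "eventually (\<lambda>n. \<mu> n (A \<inter> I n) = \<mu> n A) sequentially"
    using eventually_ge_at_top[of 1] by eventually_elim (use assms True in \<open>auto simp: smooth_def\<close>)
  then have "limsup (\<lambda>n. \<mu> n (A \<inter> I n)) = limsup (\<lambda>n. \<mu> n A)"
    by (rule Limsup_eq)
  moreover have "limsup (\<lambda>n. \<mu> n A) = 0 \<longleftrightarrow> (\<lambda>n. \<mu> n A) \<longlonglongrightarrow> 0"
  proof
    assume L: "limsup (\<lambda>n. \<mu> n A) = 0"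
    have "liminf (\<lambda>n. \<mu> n A) \<le> limsup (\<lambda>n. \<mu> n A)"
      by (rule Liminf_le_Limsup) simp
    then have "liminf (\<lambda>n. \<mu> n A) = 0" using L by simp
    with L show "(\<lambda>n. \<mu> n A) \<longlonglongrightarrow> 0"
      by (intro Liminf_eq_Limsup) auto
  next
    assume "(\<lambda>n. \<mu> n A) \<longlonglongrightarrow> 0"
    then show "limsup (\<lambda>n. \<mu> n A) = 0"
      by (intro lim_imp_Limsup) auto
  qed
  ultimately show ?thesis using True by (simp add: Z_ideal_def)
qed (simp add: Z_ideal_def)

lemma ideal_Z_ideal:
  assumes s: "smooth \<mu> I"
  shows "ideal_on_pos (Z_ideal \<mu> I)"
proof -
  have sub: "submeasure (\<mu> n)" if "n \<ge> 1" for n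
    using s that by (auto simp: smooth_def)
  have down: "B \<in> Z_ideal \<mu> I" if A: "A \<in> Z_ideal \<mu> I" and B: "B \<subseteq> A" for A B
  proof -
    have "(\<lambda>n. \<mu> n B) \<longlonglongrightarrow> 0"
    proof (rule tendsto_sandwich[of "\<lambda>_. 0" _ _ "\<lambda>n. \<mu> n A"])
      show "\<forall>\<^sub>F n in sequentially. \<mu> n B \<le> \<mu> n A"
        using eventually_ge_at_top[of 1]
        by eventually_elim (use sub A B in \<open>auto simp: submeasure_def Z_ideal_iff[OF s]\<close>)
    qed (use A in \<open>auto simp: Z_ideal_iff[OF s]\<close>)
    then show ?thesis using A B by (auto simp: Z_ideal_iff[OF s])
  qed
  have un: "A \<union> B \<in> Z_ideal \<mu> I" if A: "A \<in> Z_ideal \<mu> I" and B: "B \<in> Z_ideal \<mu> I" for A B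
  proof -
    have "(\<lambda>n. \<mu> n (A \<union> B)) \<longlonglongrightarrow> 0"
    proof (rule tendsto_sandwich[of "\<lambda>_. 0" _ _ "\<lambda>n. \<mu> n A + \<mu> n B"])
      show "\<forall>\<^sub>F n in sequentially. \<mu> n (A \<union> B) \<le> \<mu> n A + \<mu> n B"
        using eventually_ge_at_top[of 1]
        by eventually_elim (use sub A B in \<open>auto simp: submeasure_def Z_ideal_iff[OF s]\<close>)
      have "(\<lambda>n. \<mu> n A + \<mu> n B) \<longlonglongrightarrow> 0 + 0"
        using A B by (intro tendsto_add) (auto simp: Z_ideal_iff[OF s])
      then show "(\<lambda>n. \<mu> n A + \<mu> n B) \<longlonglongrightarrow> 0" by simp
    qed auto
    then show ?thesis using A B by (auto simp: Z_ideal_iff[OF s])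
  qed
  have fin: "F \<in> Z_ideal \<mu> I" if "finite F" "F \<subseteq> pos" for F
    using that
  proof (induction F rule: finite_induct)
    case empty
    have "eventually (\<lambda>n. \<mu> n {} = 0) sequentially"
      using eventually_ge_at_top[of 1]
      by eventually_elim (use sub in \<open>auto simp: submeasure_def\<close>)
    then show ?case by (simp add: Z_ideal_iff[OF s] tendsto_eventually)
  next
    case (insert k F)
    have "{k} \<in> Z_ideal \<mu> I"
      using s insert.prems by (auto simp: Z_ideal_iff[OF s] smooth_def)
    then show ?case using un[of "{k}" F] insert by simp
  qed
  have "Z_ideal \<mu> I \<subseteq> Pow pos"
    unfolding Z_ideal_def by blast
  then show ?thesis
    unfolding ideal_on_pos_def using down un fin by meson
qed

end

theory Submission
  imports Defs
begin

text \<open>If \<open>\<mu>\<^sub>n(A) \<ge> 2\<epsilon>\<close> for infinitely many \<open>n\<close>, flatness with constant \<open>d\<close> forces \<open>\<mu>\<^sub>k(A) \<ge> \<epsilon>\<close> for all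
  \<open>k \<in> [n, n + c n\<^sup>\<alpha>]\<close> with \<open>c = \<epsilon>/d\<close>, because each of the at most \<open>c n\<^sup>\<alpha>\<close> steps costs at most
  \<open>d/n\<^sup>\<alpha>\<close>. Thickness then keeps \<open>{k. \<mu>\<^sub>k(A) \<ge> \<epsilon>}\<close> out of \<open>Z\<^sub>\<nu>\<close>. The converse inclusion only uses
  that ideals contain the finite sets.\<close>

text \<open>Rewrites flatness as an additive bound. Addition has no truncation, so infinite values
  cause no trouble when steps are chained.\<close>

lemma abs_diff_leD:
  assumes "abs_diff a b \<le> e"
  shows "b \<le> a + e"
proof (cases "a < b")
  case True
  then show ?thesis
    using assms by (simp add: abs_diff_def ennreal_minus_le_iff)
next
  case False
  then have "b \<le> a"
    by simp
  also have "a \<le> a + e"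
    by simp
  finally show ?thesis .
qed

text \<open>Every positive \<open>a\<close> in \<open>ennreal\<close>, including the infinite one,
  lies above some positive real, so real thresholds suffice. This is the form in which
  \<open>J_ideal\<close> measures smallness.\<close>

lemma tendsto_0_ennreal_iff:
  fixes f :: "'a \<Rightarrow> ennreal"
  shows "(f \<longlongrightarrow> 0) F \<longleftrightarrow> (\<forall>\<epsilon>::real. \<epsilon> > 0 \<longrightarrow> (\<forall>\<^sub>F x in F. f x < ennreal \<epsilon>))"
proof
  assume "(f \<longlongrightarrow> 0) F"
  then show "\<forall>\<epsilon>::real. \<epsilon> > 0 \<longrightarrow> (\<forall>\<^sub>F x in F. f x < ennreal \<epsilon>)"
    by (auto intro: order_tendstoD(2))
next
  assume small: "\<forall>\<epsilon>::real. \<epsilon> > 0 \<longrightarrow> (\<forall>\<^sub>F x in F. f x < ennreal \<epsilon>)"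
  show "(f \<longlongrightarrow> 0) F"
  proof (rule order_tendstoI)
    fix a :: ennreal
    assume "0 < a"
    obtain r :: real where r: "r > 0" "ennreal r \<le> a"
    proof (cases a)
      case (real s)
      then show ?thesis
        using \<open>0 < a\<close> that[of s] by simp
    next
      case top
      then show ?thesis
        using that[of 1] by simp
    qed
    from small r(1) have "\<forall>\<^sub>F x in F. f x < ennreal r"
      by blast
    then show "\<forall>\<^sub>F x in F. f x < a"
      by eventually_elim (use r(2) in auto)
  qed auto
qed

lemma flat_le_iterate:
  fixes f :: "nat \<Rightarrow> ennreal"
  assumes step: "\<And>m. m \<ge> n \<Longrightarrow> abs_diff (f (m + 1)) (f m) \<le> ennreal (d / real m powr \<alpha>)"
    and "n \<ge> 1" "d > 0" "\<alpha> > 0"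
  shows "f n \<le> f (n + j) + ennreal (real j * (d / real n powr \<alpha>))"
proof (induction j)
  case (Suc j)
  \<comment> \<open>The bound \<open>d / real m powr \<alpha>\<close> decreases in \<open>m\<close>
    because \<alpha> > 0, so each later step costs at most as much as the one at
    \<open>n\<close>.\<close>
  have mono: "d / real (n + j) powr \<alpha> \<le> d / real n powr \<alpha>"
    using assms by (intro divide_left_mono powr_mono2 mult_pos_pos) auto
  have "f (n + j) \<le> f (n + j + 1) + ennreal (d / real (n + j) powr \<alpha>)"
    using step[of "n + j"] by (intro abs_diff_leD) simp
  also have "\<dots> \<le> f (n + j + 1) + ennreal (d / real n powr \<alpha>)"
    using mono by (intro add_left_mono ennreal_leI)
  finally have "f n \<le> f (n + j + 1) + ennreal (d / real n powr \<alpha>) + ennreal (real j * (d / real n powr \<alpha>))"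
    using Suc.IH by (meson add_right_mono order_trans)
  also have "\<dots> = f (n + Suc j) + ennreal (real (Suc j) * (d / real n powr \<alpha>))"
  proof -
    have "real (Suc j) * (d / real n powr \<alpha>) = d / real n powr \<alpha> + real j * (d / real n powr \<alpha>)"
      by (simp add: algebra_simps add_divide_distrib)
    \<comment> \<open>\<open>ennreal\<close> sends negative reals to 0, so it is additive only on
      nonnegative summands.\<close>
    moreover have "0 \<le> d / real n powr \<alpha>" "0 \<le> real j * (d / real n powr \<alpha>)"
      using \<open>d > 0\<close> by auto
    ultimately show ?thesis
      by (simp only: ennreal_plus add.assoc add_Suc_right add_0_right One_nat_def)
  qed
  finally show ?case .
qed simp

lemma Z_ideal_subset_J_ideal:
  assumes "smooth \<mu> K" and "ideal_on_pos \<I>"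
  shows "Z_ideal \<mu> K \<subseteq> J_ideal \<I> \<mu>"
proof
  fix A
  assume A: "A \<in> Z_ideal \<mu> K"
  have "{n \<in> pos. ennreal \<epsilon> \<le> \<mu> n A} \<in> \<I>" if "\<epsilon> > 0" for \<epsilon> :: real
  proof -
    have "\<forall>\<^sub>F n in sequentially. \<mu> n A < ennreal \<epsilon>"
      using A that by (simp add: Z_ideal_iff[OF assms(1)] tendsto_0_ennreal_iff)
    then have "finite {n. \<not> \<mu> n A < ennreal \<epsilon>}"
      by (simp add: cofinite_eq_sequentially[symmetric] eventually_cofinite)
    moreover have "{n \<in> pos. ennreal \<epsilon> \<le> \<mu> n A} \<subseteq> {n. \<not> \<mu> n A < ennreal \<epsilon>}"
      by (auto simp: not_less)
    ultimately have "finite {n \<in> pos. ennreal \<epsilon> \<le> \<mu> n A}"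
      by (rule rev_finite_subset)
    moreover have "{n \<in> pos. ennreal \<epsilon> \<le> \<mu> n A} \<subseteq> pos"
      by (rule Collect_restrict)
    moreover have "\<forall>F\<subseteq>pos. finite F \<longrightarrow> F \<in> \<I>"
      using assms(2) unfolding ideal_on_pos_def by (elim conjE)
    ultimately show ?thesis
      by blast
  qed
  then show "A \<in> J_ideal \<I> \<mu>"
    using A by (auto simp: J_ideal_def Z_ideal_def)
qed

lemma J_ideal_subset_Z_ideal:
  assumes "smooth \<mu> K" and "0 < \<alpha>" and "thick \<alpha> \<I>" and "flat \<alpha> \<mu>"
  shows "J_ideal \<I> \<mu> \<subseteq> Z_ideal \<mu> K"
proof
  fix A
  assume "A \<in> J_ideal \<I> \<mu>"
  then have A: "A \<subseteq> pos" and J: "\<And>\<epsilon>::real. \<epsilon> > 0 \<Longrightarrow> {n \<in> pos. ennreal \<epsilon> \<le> \<mu> n A} \<in> \<I>"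
    by (auto simp: J_ideal_def)
  obtain d where d: "d > 0"
    and step: "\<And>n. n \<ge> 1 \<Longrightarrow> abs_diff (\<mu> (n + 1) A) (\<mu> n A) \<le> ennreal (d / real n powr \<alpha>)"
    using assms(4) A unfolding flat_def by (metis atLeast_iff)
  have "\<forall>\<^sub>F n in sequentially. \<mu> n A < ennreal \<delta>" if "\<delta> > 0" for \<delta> :: real
  proof (rule ccontr)
    assume "\<not> ?thesis"
    then have "infinite {n. ennreal \<delta> \<le> \<mu> n A}"
      by (simp add: cofinite_eq_sequentially[symmetric] eventually_cofinite not_less)
    \<comment> \<open>Index 0 is dropped because \<open>thick\<close> counts only positive
      \<open>n\<close> and \<open>\<mu> 0\<close> is unconstrained.\<close>
    then have inf: "infinite ({n. ennreal \<delta> \<le> \<mu> n A} - {0})"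
      by simp
    \<comment> \<open>One half of \<delta> is lost to the drift of \<open>\<mu>\<close> along the
      interval; the other half survives as the threshold defining \<open>B\<close>.\<close>
    define \<epsilon> where "\<epsilon> = \<delta> / 2"
    define B where "B = {k \<in> pos. ennreal \<epsilon> \<le> \<mu> k A}"
    have eps: "\<epsilon> > 0" "\<delta> = \<epsilon> + \<epsilon>"
      using that by (auto simp: \<epsilon>_def)
    have "k \<in> B" if n: "ennreal \<delta> \<le> \<mu> n A" "n \<ge> 1"
      and k: "n \<le> k" "real k \<le> real n + \<epsilon> / d * real n powr \<alpha>" for n k
    proof -
      define j where "j = k - n"
      have kj: "k = n + j"
        using k by (simp add: j_def)
      have "real j \<le> \<epsilon> / d * real n powr \<alpha>"
        using k kj by simp
      \<comment> \<open>The interval constant \<open>\<epsilon> / d\<close> is chosen so that the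
        total drift is at most \<epsilon>.\<close>
      then have le: "real j * (d / real n powr \<alpha>) \<le> \<epsilon>"
        using d n(2) by (simp add: field_simps)
      have "ennreal \<epsilon> + ennreal \<epsilon> \<le> \<mu> n A"
        using n eps by (simp only: ennreal_plus less_imp_le)
      also have "\<dots> \<le> \<mu> (n + j) A + ennreal (real j * (d / real n powr \<alpha>))"
        by (rule flat_le_iterate) (use step n d assms(2) in auto)
      also have "\<dots> \<le> \<mu> k A + ennreal \<epsilon>"
        unfolding kj using le by (intro add_left_mono ennreal_leI)
      \<comment> \<open>Cancelling is sound because \<open>ennreal \<epsilon>\<close> is finite,
        even if \<open>\<mu> k A\<close> is infinite.\<close>
      finally have "ennreal \<epsilon> \<le> \<mu> k A"
        by (simp add: add.commute ennreal_add_left_cancel_le)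
      then show ?thesis
        using n k by (simp add: B_def)
    qed
    then have "{n. ennreal \<delta> \<le> \<mu> n A} - {0} \<subseteq>
      {n \<in> pos. {k \<in> pos. real n \<le> real k \<and> real k \<le> real n + \<epsilon> / d * real n powr \<alpha>} \<subseteq> B}"
      by auto
    with inf have "infinite
      {n \<in> pos. {k \<in> pos. real n \<le> real k \<and> real k \<le> real n + \<epsilon> / d * real n powr \<alpha>} \<subseteq> B}"
      by (meson finite_subset)
    moreover have "\<epsilon> / d > 0" "B \<subseteq> pos"
      using eps d by (auto simp: B_def)
    ultimately have "B \<notin> \<I>"
      using assms(3) unfolding thick_def by blast
    then show False
      using J[OF eps(1)] by (simp add: B_def)
  qed
  then show "A \<in> Z_ideal \<mu> K"
    using A by (simp add: Z_ideal_iff[OF assms(1)] tendsto_0_ennreal_iff)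
qed

text \<open>Both notions impose the same condition on the sets
  \<open>{k \<in> pos. x k \<notin> U}\<close>: membership of such a set in \<open>J_ideal\<close>
  unfolds to the \<epsilon>-condition.\<close>

lemma convergence_coincides_in_J_ideal:
  "convergence_coincides_in X \<I> \<mu> (J_ideal \<I> \<mu>)"
proof -
  have "{k \<in> pos. x k \<notin> U} \<subseteq> pos" for x :: "nat \<Rightarrow> 'a" and U
    by blast
  then show ?thesis
    by (simp add: convergence_coincides_in_def ideal_measure_convergent_def
        ideal_convergent_def J_ideal_def)
qed

text \<open>Supplies the witness space for the existential in
  \<open>convergence_coincides\<close>.\<close>

lemma nontrivial_Hausdorff_real: "nontrivial_Hausdorff (euclidean :: real topology)"
proof -
  have "(0::real) \<noteq> 1"
    by simp
  then show ?thesis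
    unfolding nontrivial_Hausdorff_def topspace_euclidean
    using Hausdorff_space_euclidean by blast
qed

theorem theorem2p7:
  fixes \<nu> \<mu> :: "nat \<Rightarrow> nat set \<Rightarrow> ennreal"
    and I K :: "nat \<Rightarrow> nat set"
    and \<alpha> :: real
  assumes "smooth \<nu> I"
    and "smooth \<mu> K"
    and "0 < \<alpha>" and "\<alpha> \<le> 1"
    and "thick \<alpha> (Z_ideal \<nu> I)"
    and "flat \<alpha> \<mu>"
  shows "J_ideal (Z_ideal \<nu> I) \<mu> = Z_ideal \<mu> K \<and>
    convergence_coincides (Z_ideal \<nu> I) \<mu> (Z_ideal \<mu> K) \<and>
    (\<forall>X :: 'x topology. nontrivial_Hausdorff X \<longrightarrow>
       convergence_coincides_in X (Z_ideal \<nu> I) \<mu> (Z_ideal \<mu> K))"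
proof -
  have J: "J_ideal (Z_ideal \<nu> I) \<mu> = Z_ideal \<mu> K"
    using Z_ideal_subset_J_ideal[OF assms(2) ideal_Z_ideal[OF assms(1)]]
      J_ideal_subset_Z_ideal[OF assms(2,3,5,6)] by blast
  have "convergence_coincides_in X (Z_ideal \<nu> I) \<mu> (Z_ideal \<mu> K)" for X :: "'x topology"
    using convergence_coincides_in_J_ideal[of X "Z_ideal \<nu> I" \<mu>] by (simp add: J)
  moreover have "convergence_coincides (Z_ideal \<nu> I) \<mu> (Z_ideal \<mu> K)"
    unfolding convergence_coincides_def J[symmetric]
    using nontrivial_Hausdorff_real convergence_coincides_in_J_ideal by blast
  ultimately show ?thesis
    using J by blast
qed

end
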